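(* Let $(X,T,A)$ be a soft $T_{0U}$ topological space. Then $(X,T,A)$ is a soft $T_{(0,TS)}$ space if and only if for each $x,y\in X$ with $x\not\approx y$, there exists a soft clopen set $(G,A)$ such that $x\in(G,A)$ and $y\notin(G,A)$, or there is a soft clopen set $(F,A)$ such that $y\in(F,A)$ and $x\notin(F,A)$.
   Context: A soft set over a set $X$ with parameter set $A$ is a pair $(F,A)$ with $F:A\to\mathcal P(X)$; $SS(X)_A$ is the set of all of them. $0_A$ and $1_A$ denote the soft sets with constant value $\emptyset$, respectively $X$. Soft union, soft intersection $\sqcap$, complement $(F,A)^c$ and inclusion $\sqsubseteq$ are defined parameterwise. For $x\in X$, $x\in(F,A)$ means $x\in F(a)$ for all $a\in A$; $x\notin(F,A)$ means $x\notin F(a)$ for some $a\in A$. A soft topology on $X$ is a family $T\subseteq SS(X)_A$ containing $0_A,1_A$ and closed under binary soft intersections and arbitrary soft unions; members of $T$ are soft open, their complements are soft closed, and a soft set that is both is soft clopen. A soft neighbourhood of $x$ is a soft set $(F,A)$ such that $x\in(G,A)\sqsubseteq(F,A)$ for some $(G,A)\in T$; $\mathcal U_x$ is the collection of these. Write $x\approx y$ if $x\in(G,A)$ for each $(G,A)\in\mathcal U_y$ and $y\in(F,A)$ for each $(F,A)\in\mathcal U_x$. The space is soft $T_{0U}$ if whenever $x\approx y$, for every $a\in A$ and $(F,A)\in T$: $x\in F(a)$ if and only if $y\in F(a)$. Soft $T_0$ reflection: $X_0$ is the set of equivalence classes of $\approx$ on $X$, $r_X:X\to X_0$ the canonical surjection,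 and $T_0$ is the soft topology on $X_0$ consisting of those $(F,A)\in SS(X_0)_A$ for which the soft set $a\mapsto r_X^{-1}(F(a))$ belongs to $T$; $(X_0,T_0,A)$ is the soft $T_0$ reflection of $(X,T,A)$. A soft topological space is soft totally separated if for all distinct points $x,y$ there is a soft clopen set $(G,A)$ containing one and not the other (i.e. $x\in(G,A),y\notin(G,A)$, or $y\in(G,A),x\notin(G,A)$). $(X,T,A)$ is soft $T_{(0,TS)}$ if $(X_0,T_0,A)$ is soft totally separated. *)

theory Defs
  imports "HOL-Library.FuncSet" "HOL.Equiv_Relations"
begin

text \<open>
  A soft set \<open>(F, A)\<close> over \<open>X\<close> is a function that is extensional on \<open>A\<close>
  (\<open>undefined\<close> off \<open>A\<close>), so that HOL equality coincides with equality of soft sets.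
  Every operation below therefore restricts its result to \<open>A\<close>.
  Neither \<open>X\<close> nor \<open>A\<close> is assumed to be nonempty.
\<close>

definition soft_sets :: "'x set \<Rightarrow> 'a set \<Rightarrow> ('a \<Rightarrow> 'x set) set" where
  "soft_sets X A = (A \<rightarrow>\<^sub>E Pow X)"

definition soft_empty :: "'a set \<Rightarrow> 'a \<Rightarrow> 'x set" where
  "soft_empty A = (\<lambda>a\<in>A. {})"

definition soft_full :: "'x set \<Rightarrow> 'a set \<Rightarrow> 'a \<Rightarrow> 'x set" where
  "soft_full X A = (\<lambda>a\<in>A. X)"

definition soft_inter :: "'a set \<Rightarrow> ('a \<Rightarrow> 'x set) \<Rightarrow> ('a \<Rightarrow> 'x set) \<Rightarrow> 'a \<Rightarrow> 'x set" where
  "soft_inter A F G = (\<lambda>a\<in>A. F a \<inter> G a)"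

definition soft_Union :: "'a set \<Rightarrow> ('a \<Rightarrow> 'x set) set \<Rightarrow> 'a \<Rightarrow> 'x set" where
  "soft_Union A S = (\<lambda>a\<in>A. \<Union>F\<in>S. F a)"

definition soft_compl :: "'x set \<Rightarrow> 'a set \<Rightarrow> ('a \<Rightarrow> 'x set) \<Rightarrow> 'a \<Rightarrow> 'x set" where
  "soft_compl X A F = (\<lambda>a\<in>A. X - F a)"

definition soft_subset :: "'a set \<Rightarrow> ('a \<Rightarrow> 'x set) \<Rightarrow> ('a \<Rightarrow> 'x set) \<Rightarrow> bool" where
  "soft_subset A F G \<longleftrightarrow> (\<forall>a\<in>A. F a \<subseteq> G a)"

definition soft_mem :: "'a set \<Rightarrow> 'x \<Rightarrow> ('a \<Rightarrow> 'x set) \<Rightarrow> bool" where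
  "soft_mem A x F \<longleftrightarrow> (\<forall>a\<in>A. x \<in> F a)"

definition soft_notmem :: "'a set \<Rightarrow> 'x \<Rightarrow> ('a \<Rightarrow> 'x set) \<Rightarrow> bool" where
  "soft_notmem A x F \<longleftrightarrow> (\<exists>a\<in>A. x \<notin> F a)"

definition soft_topology :: "'x set \<Rightarrow> ('a \<Rightarrow> 'x set) set \<Rightarrow> 'a set \<Rightarrow> bool" where
  "soft_topology X T A \<longleftrightarrow>
     T \<subseteq> soft_sets X A \<and> soft_empty A \<in> T \<and> soft_full X A \<in> T \<and>
     (\<forall>F\<in>T. \<forall>G\<in>T. soft_inter A F G \<in> T) \<and>
     (\<forall>S. S \<subseteq> T \<longrightarrow> soft_Union A S \<in> T)"

definition soft_closed :: "'x set \<Rightarrow> ('a \<Rightarrow> 'x set) set \<Rightarrow> 'a set \<Rightarrow> ('a \<Rightarrow> 'x set) \<Rightarrow> bool" where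
  "soft_closed X T A F \<longleftrightarrow> (\<exists>G\<in>T. F = soft_compl X A G)"

definition soft_clopen :: "'x set \<Rightarrow> ('a \<Rightarrow> 'x set) set \<Rightarrow> 'a set \<Rightarrow> ('a \<Rightarrow> 'x set) \<Rightarrow> bool" where
  "soft_clopen X T A F \<longleftrightarrow> F \<in> T \<and> soft_closed X T A F"

definition soft_nhds :: "'x set \<Rightarrow> ('a \<Rightarrow> 'x set) set \<Rightarrow> 'a set \<Rightarrow> 'x \<Rightarrow> ('a \<Rightarrow> 'x set) set" where
  "soft_nhds X T A x = {F \<in> soft_sets X A. \<exists>G\<in>T. soft_mem A x G \<and> soft_subset A G F}"

definition soft_equiv :: "'x set \<Rightarrow> ('a \<Rightarrow> 'x set) set \<Rightarrow> 'a set \<Rightarrow> 'x \<Rightarrow> 'x \<Rightarrow> bool" where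
  "soft_equiv X T A x y \<longleftrightarrow>
     (\<forall>G\<in>soft_nhds X T A y. soft_mem A x G) \<and> (\<forall>F\<in>soft_nhds X T A x. soft_mem A y F)"

definition soft_T0U :: "'x set \<Rightarrow> ('a \<Rightarrow> 'x set) set \<Rightarrow> 'a set \<Rightarrow> bool" where
  "soft_T0U X T A \<longleftrightarrow>
     (\<forall>x\<in>X. \<forall>y\<in>X. soft_equiv X T A x y \<longrightarrow> (\<forall>a\<in>A. \<forall>F\<in>T. x \<in> F a \<longleftrightarrow> y \<in> F a))"

definition soft_equiv_rel :: "'x set \<Rightarrow> ('a \<Rightarrow> 'x set) set \<Rightarrow> 'a set \<Rightarrow> ('x \<times> 'x) set" where
  "soft_equiv_rel X T A = {(x, y). x \<in> X \<and> y \<in> X \<and> soft_equiv X T A x y}"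

definition T0_points :: "'x set \<Rightarrow> ('a \<Rightarrow> 'x set) set \<Rightarrow> 'a set \<Rightarrow> 'x set set" where
  "T0_points X T A = X // soft_equiv_rel X T A"

definition T0_proj :: "'x set \<Rightarrow> ('a \<Rightarrow> 'x set) set \<Rightarrow> 'a set \<Rightarrow> 'x \<Rightarrow> 'x set" where
  "T0_proj X T A x = soft_equiv_rel X T A `` {x}"

definition soft_vimage :: "'x set \<Rightarrow> 'a set \<Rightarrow> ('x \<Rightarrow> 'y) \<Rightarrow> ('a \<Rightarrow> 'y set) \<Rightarrow> 'a \<Rightarrow> 'x set" where
  "soft_vimage X A r F = (\<lambda>a\<in>A. {x \<in> X. r x \<in> F a})"

definition T0_topology ::
    "'x set \<Rightarrow> ('a \<Rightarrow> 'x set) set \<Rightarrow> 'a set \<Rightarrow> ('a \<Rightarrow> 'x set set) set" where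
  "T0_topology X T A =
     {F \<in> soft_sets (T0_points X T A) A. soft_vimage X A (T0_proj X T A) F \<in> T}"

definition soft_totally_separated :: "'x set \<Rightarrow> ('a \<Rightarrow> 'x set) set \<Rightarrow> 'a set \<Rightarrow> bool" where
  "soft_totally_separated X T A \<longleftrightarrow>
     (\<forall>x\<in>X. \<forall>y\<in>X. x \<noteq> y \<longrightarrow>
        (\<exists>G. soft_clopen X T A G \<and>
             (soft_mem A x G \<and> soft_notmem A y G \<or> soft_mem A y G \<and> soft_notmem A x G)))"

definition soft_T0TS :: "'x set \<Rightarrow> ('a \<Rightarrow> 'x set) set \<Rightarrow> 'a set \<Rightarrow> bool" where
  "soft_T0TS X T A \<longleftrightarrow> soft_totally_separated (T0_points X T A) (T0_topology X T A) A"

lemma equiv_soft_equiv_rel: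
  assumes "soft_topology X T A"
  shows "equiv X (soft_equiv_rel X T A)"
proof -
  have T: "T \<subseteq> soft_sets X A"
    using assms by (simp add: soft_topology_def)
  have eq: "soft_equiv X T A x y \<longleftrightarrow> (\<forall>G\<in>T. soft_mem A x G \<longleftrightarrow> soft_mem A y G)" for x y
    using T unfolding soft_equiv_def soft_nhds_def soft_mem_def soft_subset_def
    by (smt (verit) mem_Collect_eq subset_iff)
  show ?thesis
    by (intro equivI refl_onI symI transI) (auto simp: soft_equiv_rel_def eq)
qed

lemma soft_topology_T0_topology:
  assumes "soft_topology X T A"
  shows "soft_topology (T0_points X T A) (T0_topology X T A) A"
proof -
  define r where "r = T0_proj X T A"
  define Y where "Y = T0_points X T A"
  have r: "r x \<in> Y" if "x \<in> X" for x
    using that by (auto simp: r_def Y_def T0_proj_def T0_points_def quotient_def)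
  have T0: "T0_topology X T A = {F \<in> soft_sets Y A. soft_vimage X A r F \<in> T}"
    by (simp add: T0_topology_def r_def Y_def)
  have "soft_vimage X A r (soft_empty A) = soft_empty A"
    by (auto simp: soft_vimage_def soft_empty_def fun_eq_iff)
  moreover have "soft_vimage X A r (soft_full Y A) = soft_full X A"
    using r by (auto simp: soft_vimage_def soft_full_def fun_eq_iff)
  moreover have "soft_vimage X A r (soft_inter A F G) =
      soft_inter A (soft_vimage X A r F) (soft_vimage X A r G)" for F G
    by (auto simp: soft_vimage_def soft_inter_def fun_eq_iff)
  moreover have "soft_vimage X A r (soft_Union A S) = soft_Union A (soft_vimage X A r ` S)" for S
    by (auto simp: soft_vimage_def soft_Union_def fun_eq_iff)
  moreover have "soft_empty A \<in> soft_sets Y A" "soft_full Y A \<in> soft_sets Y A"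
    by (auto simp: soft_sets_def soft_empty_def soft_full_def)
  moreover have "soft_inter A F G \<in> soft_sets Y A"
    if "F \<in> soft_sets Y A" for F G
    using that by (fastforce simp: soft_sets_def soft_inter_def PiE_iff)
  moreover have "soft_Union A S \<in> soft_sets Y A" if "S \<subseteq> soft_sets Y A" for S
    using that by (fastforce simp: soft_sets_def soft_Union_def PiE_iff)
  moreover have "soft_Union A (soft_vimage X A r ` S) \<in> T" if "S \<subseteq> T0_topology X T A" for S
  proof -
    have "soft_vimage X A r ` S \<subseteq> T"
      using that by (auto simp: T0)
    then show ?thesis
      using assms by (simp add: soft_topology_def)
  qed
  ultimately show ?thesis
    using assms unfolding soft_topology_def T0 Y_def[symmetric]
    by (auto simp: subset_iff)
qed

end

theory Submission
  imports Defs
begin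

text \<open>
  Taking preimages under the canonical surjection \<open>r\<close> from \<open>X\<close> to its reflection commutes with
  soft complements, and the topology of the reflection is the final one. Hence a soft set of the
  reflection is clopen exactly when its preimage is (\<open>soft_clopen_T0_topology_iff\<close>). The
  \<open>T\<^sub>0\<^sub>U\<close> axiom says that soft open sets are saturated for \<open>\<approx>\<close> parameter by parameter, so every
  soft open set is the preimage of its own image (\<open>soft_vimage_soft_image_T0_proj\<close>). Thus the
  clopen soft sets on \<open>X\<close> are precisely the preimages of the clopen soft sets on the reflection
  (\<open>soft_clopen_eq_soft_vimage\<close>). Preimages also preserve soft membership and soft non-membership
  of points, so \<open>r x\<close> and \<open>r y\<close> can be separated in the reflection if and only if \<open>x\<close> and \<open>y\<close> can
  be separated in \<open>X\<close>; finally \<open>r x \<noteq> r y\<close> means that \<open>x\<close> and \<open>y\<close> are not equivalent.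
\<close>

lemma soft_compl_soft_compl:
  assumes "F \<in> soft_sets X A"
  shows "soft_compl X A (soft_compl X A F) = F"
proof
  fix a
  show "soft_compl X A (soft_compl X A F) a = F a"
    using assms by (cases "a \<in> A") (auto simp: soft_sets_def soft_compl_def PiE_iff extensional_def)
qed

lemma soft_clopen_iff:
  assumes "soft_topology X T A"
  shows "soft_clopen X T A F \<longleftrightarrow> F \<in> T \<and> soft_compl X A F \<in> T"
proof -
  have "T \<subseteq> soft_sets X A"
    using assms by (simp add: soft_topology_def)
  then show ?thesis
    unfolding soft_clopen_def soft_closed_def by (metis soft_compl_soft_compl subsetD)
qed

lemma soft_compl_in_soft_sets: "soft_compl X A F \<in> soft_sets X A"
  by (auto simp: soft_compl_def soft_sets_def)

lemma soft_vimage_soft_compl: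
  assumes "r ` X \<subseteq> Y"
  shows "soft_vimage X A r (soft_compl Y A F) = soft_compl X A (soft_vimage X A r F)"
  using assms by (auto simp: soft_vimage_def soft_compl_def fun_eq_iff)

lemma soft_mem_soft_vimage_iff:
  assumes "x \<in> X"
  shows "soft_mem A x (soft_vimage X A r F) \<longleftrightarrow> soft_mem A (r x) F"
  using assms by (simp add: soft_mem_def soft_vimage_def)

lemma soft_notmem_soft_vimage_iff:
  assumes "x \<in> X"
  shows "soft_notmem A x (soft_vimage X A r F) \<longleftrightarrow> soft_notmem A (r x) F"
  using assms by (simp add: soft_notmem_def soft_vimage_def)

lemma T0_points_eq_image: "T0_points X T A = T0_proj X T A ` X"
  by (auto simp: T0_points_def T0_proj_def quotient_def)

lemma T0_proj_eq_iff:
  assumes "soft_topology X T A" and "x \<in> X" and "y \<in> X"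
  shows "T0_proj X T A x = T0_proj X T A y \<longleftrightarrow> soft_equiv X T A x y"
  using eq_equiv_class_iff[OF equiv_soft_equiv_rel[OF assms(1)] assms(2,3)] assms(2,3)
  by (simp add: T0_proj_def soft_equiv_rel_def)

text \<open>
  The reflection carries the final soft topology, and preimages commute with complements, so
  openness and closedness can both be tested on preimages.
\<close>

lemma soft_clopen_T0_topology_iff:
  assumes "soft_topology X T A"
  shows "soft_clopen (T0_points X T A) (T0_topology X T A) A H \<longleftrightarrow>
    H \<in> soft_sets (T0_points X T A) A \<and> soft_clopen X T A (soft_vimage X A (T0_proj X T A) H)"
proof -
  have "soft_vimage X A (T0_proj X T A) (soft_compl (T0_points X T A) A H) =
      soft_compl X A (soft_vimage X A (T0_proj X T A) H)"
    by (rule soft_vimage_soft_compl) (simp add: T0_points_eq_image)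
  then show ?thesis
    unfolding soft_clopen_iff[OF assms] soft_clopen_iff[OF soft_topology_T0_topology[OF assms]]
    by (auto simp: T0_topology_def soft_compl_in_soft_sets)
qed

definition soft_image :: "'a set \<Rightarrow> ('x \<Rightarrow> 'y) \<Rightarrow> ('a \<Rightarrow> 'x set) \<Rightarrow> 'a \<Rightarrow> 'y set" where
  "soft_image A r F = (\<lambda>a\<in>A. r ` F a)"

text \<open>
  If \<open>r x\<close> lies in the image of \<open>F a\<close>, then \<open>x\<close> is equivalent to some point of \<open>F a\<close>, and the
  \<open>T\<^sub>0\<^sub>U\<close> axiom puts \<open>x\<close> itself into \<open>F a\<close>. Without that axiom equivalence of points would only
  control membership in all the sets \<open>F a\<close> simultaneously.
\<close>

lemma soft_vimage_soft_image_T0_proj: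
  assumes top: "soft_topology X T A" and T0U: "soft_T0U X T A" and F: "F \<in> T"
  shows "soft_vimage X A (T0_proj X T A) (soft_image A (T0_proj X T A) F) = F"
proof
  fix a
  have FX: "F \<in> soft_sets X A"
    using top F by (auto simp: soft_topology_def)
  show "soft_vimage X A (T0_proj X T A) (soft_image A (T0_proj X T A) F) a = F a"
  proof (cases "a \<in> A")
    case True
    then have sub: "F a \<subseteq> X"
      using FX by (auto simp: soft_sets_def)
    have "x \<in> F a" if "x \<in> X" "y \<in> F a" "T0_proj X T A x = T0_proj X T A y" for x y
      using that sub True F T0U T0_proj_eq_iff[OF top, of x y] unfolding soft_T0U_def by blast
    then show ?thesis
      using True sub by (auto simp: soft_vimage_def soft_image_def)
  next
    case False
    then show ?thesis
      using FX by (auto simp: soft_vimage_def soft_sets_def PiE_iff extensional_def)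
  qed
qed

lemma soft_clopen_eq_soft_vimage:
  assumes top: "soft_topology X T A" and T0U: "soft_T0U X T A" and F: "soft_clopen X T A F"
  obtains H where "soft_clopen (T0_points X T A) (T0_topology X T A) A H"
    and "F = soft_vimage X A (T0_proj X T A) H"
proof
  have FT: "F \<in> T"
    using F by (simp add: soft_clopen_def)
  then have "F \<in> soft_sets X A"
    using top by (auto simp: soft_topology_def)
  then have "soft_image A (T0_proj X T A) F \<in> soft_sets (T0_points X T A) A"
    by (auto simp: soft_image_def soft_sets_def T0_points_eq_image PiE_iff)
  then show "soft_clopen (T0_points X T A) (T0_topology X T A) A (soft_image A (T0_proj X T A) F)"
    by (simp add: soft_clopen_T0_topology_iff[OF top] soft_vimage_soft_image_T0_proj[OF top T0U FT] F)
  show "F = soft_vimage X A (T0_proj X T A) (soft_image A (T0_proj X T A) F)"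
    by (simp add: soft_vimage_soft_image_T0_proj[OF top T0U FT])
qed

lemma separated_T0_proj_iff:
  assumes top: "soft_topology X T A" and T0U: "soft_T0U X T A" and xy: "x \<in> X" "y \<in> X"
  shows "(\<exists>H. soft_clopen (T0_points X T A) (T0_topology X T A) A H \<and>
      soft_mem A (T0_proj X T A x) H \<and> soft_notmem A (T0_proj X T A y) H) \<longleftrightarrow>
    (\<exists>G. soft_clopen X T A G \<and> soft_mem A x G \<and> soft_notmem A y G)"
    (is "?reflection \<longleftrightarrow> ?space")
proof
  assume ?reflection
  then show ?space
    using xy soft_clopen_T0_topology_iff[OF top]
    by (metis soft_mem_soft_vimage_iff soft_notmem_soft_vimage_iff)
next
  assume ?space
  then show ?reflection
    using xy soft_clopen_eq_soft_vimage[OF top T0U]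
    by (metis soft_mem_soft_vimage_iff soft_notmem_soft_vimage_iff)
qed

theorem proposition4p8:
  fixes X :: "'x set" and T :: "('a \<Rightarrow> 'x set) set" and A :: "'a set"
  assumes "soft_topology X T A"
    and "soft_T0U X T A"
  shows "soft_T0TS X T A \<longleftrightarrow>
    (\<forall>x\<in>X. \<forall>y\<in>X. \<not> soft_equiv X T A x y \<longrightarrow>
       (\<exists>G. soft_clopen X T A G \<and> soft_mem A x G \<and> soft_notmem A y G) \<or>
       (\<exists>F. soft_clopen X T A F \<and> soft_mem A y F \<and> soft_notmem A x F))"
proof -
  let ?r = "T0_proj X T A"
  let ?clopen = "soft_clopen (T0_points X T A) (T0_topology X T A) A"
  have "soft_T0TS X T A \<longleftrightarrow> (\<forall>x\<in>X. \<forall>y\<in>X. ?r x \<noteq> ?r y \<longrightarrow>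
      (\<exists>H. ?clopen H \<and> soft_mem A (?r x) H \<and> soft_notmem A (?r y) H) \<or>
      (\<exists>H. ?clopen H \<and> soft_mem A (?r y) H \<and> soft_notmem A (?r x) H))"
    unfolding soft_T0TS_def soft_totally_separated_def
    by (simp only: T0_points_eq_image[of X T A] ball_simps conj_disj_distribL ex_disj_distrib)
  also have "\<dots> \<longleftrightarrow> (\<forall>x\<in>X. \<forall>y\<in>X. \<not> soft_equiv X T A x y \<longrightarrow>
       (\<exists>G. soft_clopen X T A G \<and> soft_mem A x G \<and> soft_notmem A y G) \<or>
       (\<exists>F. soft_clopen X T A F \<and> soft_mem A y F \<and> soft_notmem A x F))"
    by (simp add: separated_T0_proj_iff[OF assms] T0_proj_eq_iff[OF assms(1)])
  finally show ?thesis .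
qed

end
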